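(* Let $\psi(\alpha;q)=\sum_{n=1}^\infty \frac{q^{n^2}}{(\alpha;q^2)_n}$, and let $P_{do}$ denote the set of partitions into distinct parts with the smallest part being odd. Then \[ (-\alpha;q)_\infty\,\psi(-\alpha q;-q)=-\sum_{\nu \in P_{do}}\alpha^{l(\nu)}q^{|\nu|}+\sum_{k=1}^\infty (-1)^k q^{k^2}. \]
   Context: Notation: $(a;q)_n=(1-a)(1-aq)\cdots(1-aq^{n-1})$, $(a;q)_\infty=\prod_{n\ge0}(1-aq^n)$; identities of formal power series in $q$. For a partition $\nu$, $|\nu|$ is the sum of its parts and $l(\nu)$ its number of parts. *)

theory Defs
  imports "HOL-Analysis.Analysis" "HOL-Library.Multiset"
    "HOL-Computational_Algebra.Formal_Power_Series"
begin

text \<open>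
  The variable \<open>q\<close> is the formal variable \<^term>\<open>fps_X :: 'a :: field fps\<close>.  Infinite sums and
  products are limits for the topology given by the metric on \<^typ>\<open>'a fps\<close> from the library, which
  is the \<open>q\<close>-adic one.  The base \<open>q\<close> is a parameter below because the bases
  \<open>q\<close>, \<open>-q\<close> and \<open>q\<^sup>2\<close> all occur.  A parameter free of \<open>q\<close> is a constant series
  \<^term>\<open>fps_const \<alpha>\<close> for an arbitrary \<open>\<alpha>\<close> in an arbitrary field; the field of rational functions
  in one indeterminate covers the case of an indeterminate \<open>\<alpha>\<close>.
\<close>

definition qpoch :: "'a::field fps \<Rightarrow> 'a fps \<Rightarrow> nat \<Rightarrow> 'a fps" where
  "qpoch a q n = (\<Prod>k<n. 1 - a * q ^ k)"

definition qpoch_inf :: "'a::field fps \<Rightarrow> 'a fps \<Rightarrow> 'a fps" where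
  "qpoch_inf a q = (\<Prod>k. 1 - a * q ^ k)"

definition psi :: "'a::field fps \<Rightarrow> 'a fps \<Rightarrow> 'a fps" where
  "psi a q = (\<Sum>\<^sub>\<infinity>n\<in>{1..}. q ^ (n\<^sup>2) / qpoch a (q\<^sup>2) n)"

text \<open>
  Partitions are finite multisets of positive integers, so that the number of parts of \<open>\<nu>\<close>
  is \<^term>\<open>size \<nu>\<close> and the sum of the parts is \<^term>\<open>sum_mset \<nu>\<close>.
\<close>

definition partitions :: "nat multiset set" where
  "partitions = {\<nu>. \<forall>i\<in>#\<nu>. i \<ge> 1}"

text \<open>The empty partition has no smallest part and does not belong to \<open>P_do\<close>.\<close>

definition P_do :: "nat multiset set" where
  "P_do = {\<nu> \<in> partitions.
     (\<forall>i. count \<nu> i \<le> 1) \<and> \<nu> \<noteq> {#} \<and> odd (Min (set_mset \<nu>))}"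

text \<open>
  All limits occurring in these definitions exist for the arguments of interest, so that
  none of the expressions takes a default value.
\<close>

lemma summable_fpsI:
  fixes F :: "'b \<Rightarrow> 'a::field fps"
  assumes "\<And>n. finite {x\<in>A. fps_nth (F x) n \<noteq> 0}"
  shows "F summable_on A"
  unfolding summable_on_def
  by (rule exI[of _ "Abs_fps (\<lambda>n. \<Sum>x | x \<in> A \<and> fps_nth (F x) n \<noteq> 0. fps_nth (F x) n)"],
      rule has_sum_fpsI) (use assms in auto)

lemma fps_nth_mult_X_power_eq_0:
  fixes f :: "'a::field fps"
  assumes "n < m"
  shows "fps_nth (f * fps_X ^ m) n = 0" "fps_nth (fps_X ^ m * f) n = 0"
  using assms by (simp_all add: fps_X_power_mult_right_nth fps_X_power_mult_nth)

lemma qpoch_inf_convergent: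
  fixes c :: "'a::field"
  shows "convergent_prod (\<lambda>k. 1 - fps_const c * fps_X ^ k)"
proof -
  define g where "g n = (\<Prod>i\<le>n. 1 - fps_const c * fps_X ^ (i + 1))" for n
  define P where "P = Abs_fps (\<lambda>n. fps_nth (g n) n)"
  have stable: "fps_nth (g (n + d)) n = fps_nth (g n) n" for n d
  proof (induction d)
    case (Suc d)
    have "g (n + Suc d) = g (n + d) - g (n + d) * fps_const c * fps_X ^ (n + d + 2)"
      by (simp add: g_def algebra_simps)
    thus ?case
      using Suc fps_nth_mult_X_power_eq_0(1)[of n "n + d + 2" "g (n + d) * fps_const c"] by simp
  qed simp
  have lim: "g \<longlonglongrightarrow> P"
  proof (rule tendsto_fpsI)
    fix n show "\<forall>\<^sub>F N in sequentially. fps_nth (g N) n = fps_nth P n"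
      using eventually_ge_at_top[of n]
      by eventually_elim (metis P_def fps_nth_Abs_fps le_add_diff_inverse stable)
  qed
  have "fps_nth P 0 = 1"
    by (simp add: P_def g_def)
  hence "P \<noteq> 0"
    by auto
  with lim have "raw_has_prod (\<lambda>k. 1 - fps_const c * fps_X ^ k) 1 P"
    by (simp add: raw_has_prod_def g_def[abs_def])
  thus ?thesis
    unfolding convergent_prod_def by blast
qed

lemma psi_summable:
  fixes a :: "'a::field fps"
  assumes "fps_nth a 0 = 0" "fps_nth q 0 = 0"
  shows "(\<lambda>n. q ^ (n\<^sup>2) / qpoch a (q\<^sup>2) n) summable_on {1..}"
proof (rule summable_fpsI)
  fix m
  have "fps_nth (q ^ (n\<^sup>2) / qpoch a (q\<^sup>2) n) m = 0" if "n > m" for n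
  proof -
    have "m < n\<^sup>2"
      using that power2_nat_le_imp_le[of n m] by linarith
    have zero: "fps_nth (q ^ (n\<^sup>2)) i = 0" if "i \<le> m" for i
      using that \<open>m < n\<^sup>2\<close> assms(2) startsby_zero_power_prefix by fastforce
    have "fps_nth (qpoch a (q\<^sup>2) n) 0 \<noteq> 0"
      unfolding qpoch_def by (induction n) (simp_all add: assms(1))
    hence "q ^ (n\<^sup>2) / qpoch a (q\<^sup>2) n = q ^ (n\<^sup>2) * inverse (qpoch a (q\<^sup>2) n)"
      by (rule fps_divide_unit)
    thus ?thesis
      by (simp add: fps_mult_nth zero)
  qed
  hence "{n \<in> {1..}. fps_nth (q ^ (n\<^sup>2) / qpoch a (q\<^sup>2) n) m \<noteq> 0} \<subseteq> {..m}"
    by (auto simp: not_less[symmetric])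
  thus "finite {n \<in> {1..}. fps_nth (q ^ (n\<^sup>2) / qpoch a (q\<^sup>2) n) m \<noteq> 0}"
    by (rule finite_subset) simp
qed

lemma P_do_summable:
  fixes a :: "'a::field fps"
  shows "(\<lambda>\<nu>. a ^ size \<nu> * fps_X ^ sum_mset \<nu>) summable_on P_do"
proof (rule summable_fpsI)
  fix m
  have sub: "\<nu> \<in> mset_set ` Pow {..m}"
    if "\<nu> \<in> P_do" "fps_nth (a ^ size \<nu> * fps_X ^ sum_mset \<nu>) m \<noteq> 0" for \<nu>
  proof -
    have "sum_mset \<nu> \<le> m"
      using that(2) fps_nth_mult_X_power_eq_0(1) by (meson not_le)
    hence "set_mset \<nu> \<subseteq> {..m}"
      by (auto dest: sum_mset.remove)
    moreover have "\<nu> = mset_set (set_mset \<nu>)"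
    proof (rule multiset_eqI)
      fix x
      have "count \<nu> x \<le> 1"
        using that(1) by (simp add: P_do_def)
      thus "count \<nu> x = count (mset_set (set_mset \<nu>)) x"
        by (cases "x \<in># \<nu>") (auto simp: count_mset_set' le_Suc_eq count_eq_zero_iff)
    qed
    ultimately show ?thesis
      by blast
  qed
  show "finite {\<nu> \<in> P_do. fps_nth (a ^ size \<nu> * fps_X ^ sum_mset \<nu>) m \<noteq> 0}"
    by (rule finite_subset[of _ "mset_set ` Pow {..m}"]) (use sub in auto)
qed

lemma theta_summable:
  "(\<lambda>k. (- 1) ^ k * fps_X ^ (k\<^sup>2) :: 'a::field fps) summable_on {1..}"
proof (rule summable_fpsI)
  fix m
  have "k \<le> m" if "fps_nth ((- 1) ^ k * fps_X ^ (k\<^sup>2) :: 'a fps) m \<noteq> 0" for k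
  proof -
    have "k\<^sup>2 \<le> m"
      using that fps_nth_mult_X_power_eq_0(1) by (meson not_le)
    thus ?thesis
      by (rule power2_nat_le_imp_le)
  qed
  hence "{k \<in> {1..}. fps_nth ((- 1) ^ k * fps_X ^ (k\<^sup>2) :: 'a fps) m \<noteq> 0} \<subseteq> {..m}"
    by auto
  thus "finite {k \<in> {1..}. fps_nth ((- 1) ^ k * fps_X ^ (k\<^sup>2) :: 'a fps) m \<noteq> 0}"
    by (rule finite_subset) simp
qed

end

theory Submission
  imports Defs
begin

text \<open>
  Replace \<open>\<alpha>\<close> by an arbitrary power series \<open>b\<close> and let \<open>F(b)\<close> be the left-hand side plus the sum
  over \<open>P_do\<close>.  Telescoping the series \<open>\<psi>\<close> shows that the left-hand side changes by
  \<open>-b q (-b q\<^sup>2; q)\<^sub>\<infinity>\<close> on passing from \<open>b q\<^sup>2\<close> to \<open>b\<close>.  Splitting the sets with odd minimum according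
  to whether they contain \<open>1\<close> shows that the sum over \<open>P_do\<close> changes by the opposite amount.  Hence
  \<open>F(b) = F(b q\<^bsup>2N\<^esup>)\<close>, which tends to \<open>F(0)\<close>, the theta series, as \<open>N\<close> grows.
\<close>

section \<open>Continuity of addition and multiplication of power series, and infinite sums taken
  degree by degree\<close>

lemma eventually_nth_eq_nhds_fps:
  "\<forall>\<^sub>F g in nhds (f :: 'a::group_add fps). fps_nth g n = fps_nth f n"
  using tendsto_fps_iff[of "\<lambda>g. g" f "nhds f"] by (simp add: filterlim_ident)

text \<open>This instance and the next put the limit laws for sums and products, and the algebra of
  \<open>has_sum\<close>, at the disposal of power series. Each coefficient of a result depends on
  finitely many coefficients of the arguments, and these are eventually constant.\<close>

instance fps :: (ab_group_add) topological_ab_group_add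
proof
  fix f g :: "'a fps"
  show "((\<lambda>x. fst x + snd x) \<longlongrightarrow> f + g) (nhds f \<times>\<^sub>F nhds g)"
  proof (rule tendsto_fpsI)
    fix n
    have "\<forall>\<^sub>F x in nhds f \<times>\<^sub>F nhds g. fps_nth (fst x) n = fps_nth f n \<and> fps_nth (snd x) n = fps_nth g n"
      using eventually_prodI[OF eventually_nth_eq_nhds_fps eventually_nth_eq_nhds_fps] .
    thus "\<forall>\<^sub>F x in nhds f \<times>\<^sub>F nhds g. fps_nth (fst x + snd x) n = fps_nth (f + g) n"
      by eventually_elim simp
  qed
  show "(uminus \<longlongrightarrow> - f) (nhds f)"
  proof (rule tendsto_fpsI)
    fix n
    show "\<forall>\<^sub>F g in nhds f. fps_nth (- g) n = fps_nth (- f) n"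
      using eventually_nth_eq_nhds_fps[of n f] by eventually_elim simp
  qed
qed

instance fps :: (comm_ring_1) topological_semigroup_mult
proof
  fix f g :: "'a fps"
  show "((\<lambda>x. fst x * snd x) \<longlongrightarrow> f * g) (nhds f \<times>\<^sub>F nhds g)"
  proof (rule tendsto_fpsI)
    fix n
    have all: "\<forall>\<^sub>F h' in nhds h. \<forall>i\<in>{..n}. fps_nth h' i = fps_nth h i" for h :: "'a fps"
      by (rule eventually_ball_finite) (simp_all add: eventually_nth_eq_nhds_fps)
    have "\<forall>\<^sub>F x in nhds f \<times>\<^sub>F nhds g. (\<forall>i\<in>{..n}. fps_nth (fst x) i = fps_nth f i) \<and>
            (\<forall>i\<in>{..n}. fps_nth (snd x) i = fps_nth g i)"
      using eventually_prodI[OF all all] .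
    thus "\<forall>\<^sub>F x in nhds f \<times>\<^sub>F nhds g. fps_nth (fst x * snd x) n = fps_nth (f * g) n"
      by eventually_elim (simp add: fps_mult_nth)
  qed
qed

lemma fps_nth_0_prod: "fps_nth (prod f A) 0 = (\<Prod>x\<in>A. fps_nth (f x) 0)"
  by (induction A rule: infinite_finite_induct) simp_all

text \<open>Summability amounts to finite support in every degree, which passes to
  subfamilies.\<close>

lemma summable_on_subset_fps:
  fixes F :: "'b \<Rightarrow> 'a::field fps"
  assumes "F summable_on A" "B \<subseteq> A"
  shows "F summable_on B"
proof (rule summable_fpsI)
  fix n
  show "finite {x \<in> B. fps_nth (F x) n \<noteq> 0}"
    using has_sum_fpsD(1)[OF has_sum_infsum[OF assms(1)], of n]
    by (rule finite_subset[rotated]) (use assms(2) in auto)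
qed

text \<open>Agreement in degree \<open>n\<close> is uniform over \<open>A\<close>, so eventually
  \<open>F i\<close> and \<open>G\<close> have the same finite support in that degree and the same
  finite sum over it.\<close>

lemma tendsto_infsum_fps:
  fixes F :: "'i \<Rightarrow> 'b \<Rightarrow> 'a::ab_group_add fps"
  assumes "\<And>i. F i summable_on A" "G summable_on A"
    and "\<And>n. \<forall>\<^sub>F i in L. \<forall>x\<in>A. fps_nth (F i x) n = fps_nth (G x) n"
  shows "((\<lambda>i. infsum (F i) A) \<longlongrightarrow> infsum G A) L"
proof (rule tendsto_fpsI)
  fix n
  show "\<forall>\<^sub>F i in L. fps_nth (infsum (F i) A) n = fps_nth (infsum G A) n"
    using assms(3)[of n]
  proof eventually_elim
    case (elim i)
    hence "{x \<in> A. fps_nth (F i x) n \<noteq> 0} = {x \<in> A. fps_nth (G x) n \<noteq> 0}"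
      by auto
    thus ?case
      using elim assms(1,2) by (auto simp: has_sum_fpsD(2)[OF has_sum_infsum] intro!: sum.cong)
  qed
qed

section \<open>Generating functions of finite sets and the infinite product\<close>

text \<open>Finite sets model partitions into distinct parts. Letting \<open>b\<close> be a series
  rather than a constant allows the substitution of \<open>b * fps_X ^ 2\<close> for
  \<open>b\<close>.\<close>

definition set_weight :: "'a::field fps \<Rightarrow> nat set \<Rightarrow> 'a fps" where
  "set_weight b S = b ^ card S * fps_X ^ (\<Sum>S)"

text \<open>The sets may contain \<open>0\<close>, since the product \<open>(-b; q)\<^sub>\<infinity>\<close> starts with the factor \<open>1 + b\<close>.\<close>

definition set_gf :: "'a::field fps \<Rightarrow> 'a fps" where
  "set_gf b = infsum (set_weight b) {S. finite S}"

definition odd_Min_sets :: "nat set set" where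
  "odd_Min_sets = {S. finite S \<and> S \<noteq> {} \<and> odd (Min S)}"

definition odd_Min_gf :: "'a::field fps \<Rightarrow> 'a fps" where
  "odd_Min_gf b = infsum (set_weight b) odd_Min_sets"

text \<open>A set whose sum is at most \<open>n\<close> lies in \<open>{..n}\<close>, so only
  finitely many sets contribute in degree \<open>n\<close>.\<close>

lemma set_weight_summable:
  assumes "A \<subseteq> {S. finite S}"
  shows "set_weight b summable_on A"
proof (rule summable_fpsI)
  fix n
  have "S \<subseteq> {..n}" if "S \<in> A" "fps_nth (set_weight b S) n \<noteq> 0" for S
  proof -
    have "\<Sum>S \<le> n"
      using that(2) fps_nth_mult_X_power_eq_0(1) unfolding set_weight_def by (meson not_le)
    moreover have "x \<le> \<Sum>S" if "x \<in> S" for x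
      using \<open>S \<in> A\<close> assms that by (intro member_le_sum[where f = "\<lambda>x. x"]) auto
    ultimately show ?thesis
      using order_trans by blast
  qed
  hence "{S \<in> A. fps_nth (set_weight b S) n \<noteq> 0} \<subseteq> Pow {..n}"
    by blast
  thus "finite {S \<in> A. fps_nth (set_weight b S) n \<noteq> 0}"
    by (rule finite_subset) simp
qed

lemma has_sum_set_gf: "(set_weight b has_sum set_gf b) {S. finite S}"
  unfolding set_gf_def by (intro has_sum_infsum set_weight_summable) simp

lemma has_sum_odd_Min_gf: "(set_weight b has_sum odd_Min_gf b) odd_Min_sets"
  unfolding odd_Min_gf_def
  by (intro has_sum_infsum set_weight_summable) (auto simp: odd_Min_sets_def)

text \<open>A nonempty \<open>S\<close> acquires the factor \<open>fps_X ^ (2 * N * card S)\<close>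
  and drops out of degree \<open>n\<close> once \<open>N > n\<close>. The empty set keeps weight 1
  throughout.\<close>

lemma tendsto_set_weight_0:
  fixes b :: "'a::field fps"
  assumes "A \<subseteq> {S. finite S}"
  shows "(\<lambda>N. infsum (set_weight (b * fps_X ^ (2 * N))) A) \<longlonglongrightarrow> infsum (set_weight 0) A"
proof (rule tendsto_infsum_fps)
  fix n
  show "\<forall>\<^sub>F N in sequentially. \<forall>S\<in>A.
          fps_nth (set_weight (b * fps_X ^ (2 * N)) S) n = fps_nth (set_weight 0 S) n"
    using eventually_gt_at_top[of n]
  proof eventually_elim
    case (elim N)
    have "fps_nth (set_weight (b * fps_X ^ (2 * N)) S) n = fps_nth (set_weight 0 S) n"
      if "S \<in> A" for S
    proof (cases "S = {}")
      case False
      with that assms have "card S \<noteq> 0"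
        by auto
      hence "n < 2 * N * card S"
        using elim by (cases "card S") auto
      moreover have "set_weight (b * fps_X ^ (2 * N)) S =
          b ^ card S * fps_X ^ (\<Sum>S) * fps_X ^ (2 * N * card S)"
        unfolding set_weight_def power_mult_distrib power_mult by (simp only: mult_ac)
      moreover have "set_weight (0 :: 'a fps) S = 0"
        using \<open>card S \<noteq> 0\<close> by (simp add: set_weight_def)
      ultimately show ?thesis
        by (simp add: fps_nth_mult_X_power_eq_0)
    qed (simp add: set_weight_def)
    thus ?case ..
  qed
qed (use assms in \<open>auto intro: set_weight_summable\<close>)

lemma prod_tendsto_set_gf:
  "(\<lambda>n. \<Prod>i\<le>n. 1 + b * fps_X ^ i) \<longlonglongrightarrow> set_gf b"
proof -
  have prod_eq: "(\<Prod>i\<le>n. 1 + b * fps_X ^ i) = sum (set_weight b) (Pow {..n})" for n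
    using prod_add[of "{..n}" "\<lambda>i. b * fps_X ^ i" "\<lambda>_. 1"]
    by (auto simp: add.commute set_weight_def prod.distrib power_sum intro!: sum.cong)
  \<comment> \<open>Expanding the product gives a partial sum over \<open>Pow {..n}\<close>. These
    power sets are cofinal: any finite family of finite sets is contained in one of them.\<close>
  have "filterlim (\<lambda>n. Pow {..n}) (finite_subsets_at_top {S. finite S}) sequentially"
    unfolding filterlim_finite_subsets_at_top
  proof safe
    fix Y :: "nat set set"
    assume Y: "finite Y" "Y \<subseteq> {S. finite S}"
    hence "finite (\<Union>Y)"
      by auto
    then obtain m where m: "\<Union>Y \<subseteq> {..m}"
      by (meson finite_nat_iff_bounded_le)
    show "\<forall>\<^sub>F n in sequentially. finite (Pow {..n}) \<and> Y \<subseteq> Pow {..n} \<and> Pow {..n} \<subseteq> {S. finite S}"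
      using eventually_ge_at_top[of m]
    proof eventually_elim
      case (elim n)
      hence "\<Union>Y \<subseteq> {..n}"
        using m by (meson atMost_subset_iff order_trans)
      thus ?case
        by (auto intro: finite_subset[OF _ finite_atMost])
    qed
  qed
  from filterlim_compose[OF has_sum_set_gf[unfolded has_sum_def] this] show ?thesis
    by (simp only: prod_eq)
qed

lemma set_gf_rec: "set_gf b = (1 + b) * set_gf (b * fps_X)"
proof (rule LIMSEQ_unique)
  show "(\<lambda>n. \<Prod>i\<le>Suc n. 1 + b * fps_X ^ i) \<longlonglongrightarrow> set_gf b"
    using prod_tendsto_set_gf by (rule LIMSEQ_Suc)
  have "(\<Prod>i\<le>Suc n. 1 + b * fps_X ^ i) = (1 + b) * (\<Prod>i\<le>n. 1 + b * fps_X * fps_X ^ i)" for n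
    by (subst prod.atMost_Suc_shift) (simp add: mult.assoc)
  thus "(\<lambda>n. \<Prod>i\<le>Suc n. 1 + b * fps_X ^ i) \<longlonglongrightarrow> (1 + b) * set_gf (b * fps_X)"
    using prod_tendsto_set_gf by (simp only:) (intro tendsto_intros)
qed

lemma set_gf_nth_0:
  assumes "fps_nth b 0 = 0"
  shows "fps_nth (set_gf b) 0 = 1"
proof -
  have "\<forall>\<^sub>F n in sequentially. fps_nth (\<Prod>i\<le>n. 1 + b * fps_X ^ i) 0 = fps_nth (set_gf b) 0"
    using prod_tendsto_set_gf[of b] unfolding tendsto_fps_iff by blast
  thus ?thesis
    using assms by (simp add: fps_nth_0_prod)
qed

lemma qpoch_inf_eq_set_gf: "qpoch_inf (- b) fps_X = set_gf b"
proof -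
  let ?f = "\<lambda>k. 1 + b * fps_X ^ k"
  have raw: "raw_has_prod ?f 1 (set_gf (b * fps_X))"
    unfolding raw_has_prod_def
  proof
    show "(\<lambda>n. \<Prod>i\<le>n. 1 + b * fps_X ^ (i + 1)) \<longlonglongrightarrow> set_gf (b * fps_X)"
      using prod_tendsto_set_gf[of "b * fps_X"] by (simp add: mult_ac)
    show "set_gf (b * fps_X) \<noteq> 0"
      using set_gf_nth_0[of "b * fps_X"] by auto
  qed
  have "?f has_prod set_gf b"
  \<comment> \<open>Only the factor at index 0 can vanish, as the others have constant coefficient
    1. \<open>has_prod\<close> handles a zero factor separately and then asks for a nonzero limit of
    the remaining factors, which \<open>raw\<close> supplies.\<close>
  proof (cases "1 + b = 0")
    case True
    hence "set_gf b = 0" "?f 0 = 0"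
      by (simp_all add: set_gf_rec[of b])
    thus ?thesis
      using raw unfolding has_prod_def One_nat_def by blast
  next
    case False
    hence "set_gf b \<noteq> 0"
      using raw by (simp add: set_gf_rec[of b] raw_has_prod_def)
    thus ?thesis
      using prod_tendsto_set_gf by (simp add: has_prod_def raw_has_prod_def)
  qed
  thus ?thesis
    unfolding qpoch_inf_def using has_prod_unique by fastforce
qed

section \<open>The recursion for sets with odd minimum, and their translation into
  partitions\<close>

lemma set_weight_shift:
  "set_weight b ((\<lambda>x. x + 2) ` S) = set_weight (b * fps_X ^ 2) S"
proof -
  have "inj_on (\<lambda>x. x + 2 :: nat) S"
    by (simp add: inj_on_def)
  hence eqs: "card ((\<lambda>x. x + 2) ` S) = card S" "(\<Sum>((\<lambda>x. x + 2) ` S)) = (\<Sum>S) + 2 * card S"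
    using sum.distrib[of "\<lambda>x. x" "\<lambda>_. 2" S] by (simp_all add: card_image sum.reindex)
  show ?thesis
    unfolding set_weight_def eqs power_mult_distrib power_add power_mult by (simp only: mult_ac)
qed

lemma set_weight_insert:
  assumes "finite S" "x \<notin> S"
  shows "set_weight b (insert x S) = b * fps_X ^ x * set_weight b S"
  using assms by (simp add: set_weight_def power_add mult_ac)

text \<open>Adding 2 to every element preserves the parity of the minimum. Once 1 is present, the
  elements from 2 on are arbitrary; if 1 is absent, lowering by 2 leaves a set with odd
  minimum.\<close>

lemma odd_Min_sets_decomp:
  "odd_Min_sets = (\<lambda>S. insert 1 ((\<lambda>x. x + 2) ` S)) ` {S. finite S} \<union>
                  (\<lambda>S. (\<lambda>x. x + 2) ` S) ` odd_Min_sets" (is "_ = ?A \<union> ?B")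
proof (intro equalityI subsetI)
  fix S assume "S \<in> odd_Min_sets"
  hence S: "finite S" "S \<noteq> {}" "odd (Min S)"
    by (auto simp: odd_Min_sets_def)
  define T where "T = (\<lambda>x. x + 2) -` S"
  have "finite T"
    unfolding T_def using S by (intro finite_vimageI) (auto simp: inj_def)
  \<comment> \<open>Otherwise the minimum would be 0, which is even.\<close>
  have "0 \<notin> S"
    using S by (metis Min_eqI even_zero le0)
  have T: "(\<lambda>x. x + 2) ` T = S - {1}"
  proof (intro equalityI subsetI)
    fix x assume "x \<in> S - {1}"
    with \<open>0 \<notin> S\<close> have "x \<ge> 2"
      by (metis DiffE One_nat_def Suc_1 insertI1 less_2_cases not_le)
    thus "x \<in> (\<lambda>x. x + 2) ` T"
      using \<open>x \<in> S - {1}\<close> by (intro image_eqI[of _ _ "x - 2"]) (simp_all add: T_def del: add_2_eq_Suc')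
  qed (auto simp: T_def)
  show "S \<in> ?A \<union> ?B"
  proof (cases "1 \<in> S")
    case True
    hence "S = insert 1 ((\<lambda>x. x + 2) ` T)"
      unfolding T by blast
    thus ?thesis
      using \<open>finite T\<close> by blast
  next
    case False
    hence eq: "S = (\<lambda>x. x + 2) ` T"
      unfolding T by simp
    hence "T \<noteq> {}"
      using S by auto
    have "Min S = Min T + 2"
      unfolding eq using \<open>finite T\<close> \<open>T \<noteq> {}\<close>
      by (subst mono_Min_commute[symmetric]) (auto simp: mono_def)
    hence "T \<in> odd_Min_sets"
      using S \<open>finite T\<close> \<open>T \<noteq> {}\<close> by (simp add: odd_Min_sets_def)
    thus ?thesis
      using eq by blast
  qed
next
  fix S assume "S \<in> ?A \<union> ?B"
  thus "S \<in> odd_Min_sets"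
  proof
    assume "S \<in> ?A"
    then obtain T where T: "finite T" "S = insert 1 ((\<lambda>x. x + 2) ` T)"
      by blast
    hence "Min S = 1"
      by (intro Min_eqI) auto
    thus ?thesis
      using T by (simp add: odd_Min_sets_def)
  next
    assume "S \<in> ?B"
    then obtain T where T: "finite T" "T \<noteq> {}" "odd (Min T)" "S = (\<lambda>x. x + 2) ` T"
      by (auto simp: odd_Min_sets_def)
    have "Min S = Min T + 2"
      unfolding T(4) using T(1,2) by (subst mono_Min_commute[symmetric]) (auto simp: mono_def)
    thus ?thesis
      using T by (simp add: odd_Min_sets_def)
  qed
qed

text \<open>The last summand counts the sets containing 1. Its factor
  \<open>set_gf (b * fps_X ^ 2)\<close> admits the element 0, which becomes the part 2 after the
  shift.\<close>

lemma odd_Min_gf_rec: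
  "odd_Min_gf b = odd_Min_gf (b * fps_X ^ 2) + b * fps_X * set_gf (b * fps_X ^ 2)"
proof -
  let ?sh = "\<lambda>S. (\<lambda>x. x + 2 :: nat) ` S" and ?c = "b * fps_X ^ 2"
  have inj: "inj ?sh"
    by (rule injI) (simp add: inj_image_eq_iff inj_def)
  have "inj (\<lambda>S. insert 1 (?sh S))"
    by (rule injI, rule injD[OF inj], subst (asm) insert_ident) auto
  moreover have "(set_weight b \<circ> (\<lambda>S. insert 1 (?sh S)) has_sum b * fps_X * set_gf ?c) {S. finite S}"
  proof -
    have "((\<lambda>S. b * fps_X * set_weight ?c S) has_sum b * fps_X * set_gf ?c) {S. finite S}"
      by (intro has_sum_cmult_right has_sum_set_gf)
    moreover have "(set_weight b \<circ> (\<lambda>S. insert 1 (?sh S))) S = b * fps_X * set_weight ?c S"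
      if "finite S" for S
      using that set_weight_insert[of "?sh S" 1 b] set_weight_shift[of b S] by auto
    ultimately show ?thesis
      by (subst has_sum_cong[of _ _ "\<lambda>S. b * fps_X * set_weight ?c S"]) simp_all
  qed
  ultimately have A: "(set_weight b has_sum b * fps_X * set_gf ?c)
      ((\<lambda>S. insert 1 (?sh S)) ` {S. finite S})"
    by (subst has_sum_reindex) (auto intro: inj_on_subset)
  have "(set_weight b \<circ> ?sh has_sum odd_Min_gf ?c) odd_Min_sets"
    using has_sum_odd_Min_gf[of ?c] by (simp only: o_def set_weight_shift)
  hence B: "(set_weight b has_sum odd_Min_gf ?c) (?sh ` odd_Min_sets)"
    by (subst has_sum_reindex) (use inj in \<open>auto intro: inj_on_subset\<close>)
  \<comment> \<open>The two images are disjoint because 1 is not of the form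
    \<open>x + 2\<close>.\<close>
  have "(set_weight b has_sum (b * fps_X * set_gf ?c + odd_Min_gf ?c)) odd_Min_sets"
    by (subst odd_Min_sets_decomp, rule has_sum_Un_disjoint[OF A B]) fastforce
  from has_sum_unique[OF has_sum_odd_Min_gf this] show ?thesis
    by (simp only: add.commute)
qed

text \<open>A multiset without repetition is determined by its support, and an odd minimum already
  forces all elements to be positive.\<close>

lemma odd_Min_gf_eq_P_do:
  "odd_Min_gf b = (\<Sum>\<^sub>\<infinity>\<nu>\<in>P_do. b ^ size \<nu> * fps_X ^ sum_mset \<nu>)"
proof -
  have "(set_weight b has_sum odd_Min_gf b) odd_Min_sets \<longleftrightarrow>
        ((\<lambda>\<nu>. b ^ size \<nu> * fps_X ^ sum_mset \<nu>) has_sum odd_Min_gf b) P_do"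
  proof (rule has_sum_reindex_bij_witness[where j = mset_set and i = set_mset])
    fix \<nu> :: "nat multiset" assume "\<nu> \<in> P_do"
    hence \<nu>: "\<forall>i\<in>#\<nu>. i \<ge> 1" "\<forall>i. count \<nu> i \<le> 1" "\<nu> \<noteq> {#}" "odd (Min (set_mset \<nu>))"
      by (auto simp: P_do_def partitions_def)
    thus "set_mset \<nu> \<in> odd_Min_sets"
      by (simp add: odd_Min_sets_def)
    show "mset_set (set_mset \<nu>) = \<nu>"
    proof (rule multiset_eqI)
      fix x
      show "count (mset_set (set_mset \<nu>)) x = count \<nu> x"
        using \<nu>(2)[rule_format, of x]
        by (cases "x \<in># \<nu>") (auto simp: count_mset_set' le_Suc_eq count_eq_zero_iff)
    qed
  next
    fix S :: "nat set" assume "S \<in> odd_Min_sets"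
    hence S: "finite S" "S \<noteq> {}" "odd (Min S)"
      by (auto simp: odd_Min_sets_def)
    have "i \<ge> 1" if "i \<in> S" for i
      using S that Min_le[of S i] by (metis One_nat_def Suc_leI dvd_0_right le_trans neq0_conv)
    thus "mset_set S \<in> P_do"
      using S by (auto simp: P_do_def partitions_def count_mset_set' mset_set_empty_iff)
    show "b ^ size (mset_set S) * fps_X ^ sum_mset (mset_set S) = set_weight b S"
      by (simp add: set_weight_def sum_unfold_sum_mset)
    show "set_mset (mset_set S) = S"
      using S by simp
  qed auto
  thus ?thesis
    using has_sum_odd_Min_gf infsumI by metis
qed

section \<open>Telescoping the series psi\<close>

definition psi_term :: "'a::field fps \<Rightarrow> nat \<Rightarrow> 'a fps" where
  "psi_term b n = (- fps_X) ^ (n\<^sup>2) / qpoch (- b * fps_X) ((- fps_X)\<^sup>2) n"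

lemma psi_eq_infsum: "psi (- b * fps_X) (- fps_X) = infsum (psi_term b) {1..}"
  by (simp add: psi_def psi_term_def[abs_def])

lemma psi_term_summable: "psi_term b summable_on {1..}"
  unfolding psi_term_def by (rule psi_summable) simp_all

text \<open>The denominator has constant coefficient 1 and is thus a unit. Clearing it lets later
  arguments avoid division.\<close>

lemma psi_term_mult:
  "psi_term b n * (\<Prod>k<n. 1 + b * fps_X ^ (2 * k + 1)) = (- 1) ^ n * fps_X ^ (n\<^sup>2)"
proof -
  let ?D = "\<Prod>k<n. 1 + b * fps_X ^ (2 * k + 1)"
  have "qpoch (- b * fps_X) ((- fps_X)\<^sup>2) n = ?D"
    by (simp add: qpoch_def mult_ac flip: power_mult)
  moreover have "fps_nth ?D 0 = 1"
    by (simp add: fps_nth_0_prod)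
  \<comment> \<open>The sign is \<open>(- 1) ^ n\<close> because a number and its square have the
    same parity.\<close>
  moreover have "(- fps_X :: 'a fps) ^ (n\<^sup>2) = (- 1) ^ n * fps_X ^ (n\<^sup>2)"
    by (subst power_minus) (simp add: minus_one_power_iff)
  ultimately show ?thesis
    by (simp add: psi_term_def fps_divide_unit mult.assoc inverse_mult_eq_1)
qed

lemma psi_denominator_nonzero: "(\<Prod>k<n. 1 + b * fps_X ^ (2 * k + 1) :: 'a::field fps) \<noteq> 0"
  by (rule fps_nonzeroI[of _ 0]) (simp add: fps_nth_0_prod)

lemma psi_term_unique:
  assumes "t * (\<Prod>k<n. 1 + b * fps_X ^ (2 * k + 1)) = (- 1) ^ n * fps_X ^ (n\<^sup>2)"
  shows "psi_term b n = t"
  using assms psi_term_mult[of b n] psi_denominator_nonzero[of b n] by (metis mult_right_cancel)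

lemma psi_term_0: "psi_term 0 = (\<lambda>n. (- 1) ^ n * fps_X ^ (n\<^sup>2))"
  by (rule ext, rule psi_term_unique) simp

text \<open>\<open>D (Suc n)\<close> is a common multiple of the three denominators. After
  multiplication by it, both sides equal \<open>s * a * b * (1 + x + b * x)\<close>.\<close>

lemma psi_term_rec:
  fixes b :: "'a::field fps"
  shows "(1 + b) * (1 + b * fps_X) * psi_term b n - psi_term (b * fps_X ^ 2) n =
         b * (1 + b * fps_X) * (psi_term b n - psi_term b (Suc n))"
proof -
  define D where "D n = (\<Prod>k<n. 1 + b * fps_X ^ (2 * k + 1))" for n
  define D' where "D' = (\<Prod>k<n. 1 + b * fps_X ^ 2 * fps_X ^ (2 * k + 1))"
  define s where "s = ((- 1) ^ n * fps_X ^ (n\<^sup>2) :: 'a fps)"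
  define x :: "'a fps" where "x = fps_X ^ (2 * n + 1)"
  define a where "a = 1 + b * fps_X"
  define t where "t = psi_term b n"
  define t' where "t' = psi_term (b * fps_X ^ 2) n"
  define t'' where "t'' = psi_term b (Suc n)"
  have "D (Suc n) = D n * (1 + b * x)"
    by (simp add: D_def x_def)
  moreover have "t * D n = s"
    using psi_term_mult[of b n] by (simp only: D_def s_def t_def)
  ultimately have t: "t * D (Suc n) = s * (1 + b * x)"
    by (simp only: mult.assoc[symmetric])
  \<comment> \<open>Passing to \<open>b * fps_X ^ 2\<close> moves each factor to the next one, so
    here the first factor is split off instead of the last.\<close>
  have "D (Suc n) = D' * a"
    unfolding D_def D'_def a_def
    by (subst prod.lessThan_Suc_shift) (simp add: power2_eq_square mult_ac)
  moreover have "t' * D' = s"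
    using psi_term_mult[of "b * fps_X ^ 2" n] by (simp only: D'_def s_def t'_def)
  ultimately have t': "t' * D (Suc n) = s * a"
    by (simp only: mult.assoc[symmetric])
  have "(Suc n)\<^sup>2 = n\<^sup>2 + (2 * n + 1)"
    by (simp add: power2_eq_square)
  hence t'': "t'' * D (Suc n) = - (s * x)"
    using psi_term_mult[of b "Suc n"] unfolding D_def s_def t''_def x_def
    by (simp only: power_add) simp
  have "((1 + b) * a * t - t') * D (Suc n) = (1 + b) * a * (t * D (Suc n)) - t' * D (Suc n)"
    by (simp add: algebra_simps)
  also have "\<dots> = b * a * (t * D (Suc n) - t'' * D (Suc n))"
    unfolding t t' t'' by (simp add: algebra_simps)
  also have "\<dots> = b * a * (t - t'') * D (Suc n)"
    by (simp add: algebra_simps)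
  finally have "(1 + b) * a * t - t' = b * a * (t - t'')"
    using psi_denominator_nonzero[of b "Suc n"] unfolding D_def by (metis mult_right_cancel)
  thus ?thesis
    by (simp only: a_def t_def t'_def t''_def)
qed

text \<open>Summing \<open>psi_term_rec\<close> over \<open>n\<close> from 1 on telescopes the
  right-hand side to the first term of the series, whose denominator \<open>1 + b * fps_X\<close>
  cancels.\<close>

lemma psi_rec:
  "(1 + b) * (1 + b * fps_X) * psi (- b * fps_X) (- fps_X) =
   psi (- (b * fps_X ^ 2) * fps_X) (- fps_X) - b * fps_X"
proof -
  let ?psi = "\<lambda>b. infsum (psi_term b) {1..}"
  have sums: "(psi_term c has_sum ?psi c) {1..}" for c :: "'a fps"
    by (intro has_sum_infsum psi_term_summable)
  \<comment> \<open>This tail is at once the series without its first term and the sum of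
    \<open>psi_term b (Suc n)\<close> over \<open>n\<close> from 1 on.\<close>
  define u where "u = infsum (psi_term b) {2..}"
  have u: "(psi_term b has_sum u) {2..}"
    unfolding u_def
    by (intro has_sum_infsum summable_on_subset_fps[OF psi_term_summable]) simp
  have "(psi_term b has_sum (psi_term b 1 + u)) ({1} \<union> {2..})"
    by (rule has_sum_Un_disjoint[OF _ u]) (simp_all add: has_sum_finiteI)
  moreover have "{1} \<union> {2..} = {1 :: nat..}"
    by auto
  ultimately have psi_u: "?psi b = psi_term b 1 + u"
    by (simp add: infsumI)
  have "{2..} = Suc ` {1..}"
    by (auto simp: image_iff Bex_def) presburger
  hence "((\<lambda>n. psi_term b (Suc n)) has_sum u) {1..}"
    using u by (simp add: has_sum_reindex o_def)
  hence "((\<lambda>n. b * (1 + b * fps_X) * (psi_term b n + - psi_term b (Suc n))) has_sum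
           b * (1 + b * fps_X) * (?psi b + - u)) {1..}"
    by (intro has_sum_cmult_right has_sum_add sums has_sum_uminusI)
  moreover have "((\<lambda>n. (1 + b) * (1 + b * fps_X) * psi_term b n + - psi_term (b * fps_X ^ 2) n) has_sum
           (1 + b) * (1 + b * fps_X) * ?psi b + - ?psi (b * fps_X ^ 2)) {1..}"
    by (intro has_sum_cmult_right has_sum_add sums has_sum_uminusI)
  ultimately have "(1 + b) * (1 + b * fps_X) * ?psi b + - ?psi (b * fps_X ^ 2) =
      b * (1 + b * fps_X) * (?psi b + - u)"
    using psi_term_rec[of b] by (simp add: has_sum_unique)
  also have "\<dots> = b * (psi_term b 1 * (1 + b * fps_X))"
    unfolding psi_u by (simp add: mult_ac)
  also have "psi_term b 1 * (1 + b * fps_X) = - fps_X"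
    using psi_term_mult[of b 1] by simp
  finally show ?thesis
    unfolding psi_eq_infsum by (simp add: algebra_simps)
qed

section \<open>Limits as \<open>b\<close> is multiplied by growing powers of q\<close>

lemma dvd_prod_one_plus_minus_one:
  fixes c :: "'a::comm_ring_1"
  shows "c dvd (\<Prod>k<(n::nat). 1 + c * f k) - 1"
proof (induction n)
  case (Suc n)
  have "(\<Prod>k<Suc n. 1 + c * f k) - 1 = ((\<Prod>k<n. 1 + c * f k) - 1) + c * ((\<Prod>k<n. 1 + c * f k) * f n)"
    by (simp add: algebra_simps)
  thus ?case
    using Suc by (metis dvd_add dvd_triv_left)
qed simp

text \<open>Modulo \<open>c = b * fps_X ^ (2 * N)\<close> every denominator is 1, so each term
  agrees with its value at \<open>b = 0\<close> in all degrees below \<open>2 * N\<close>, uniformly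
  in the index \<open>k\<close>.\<close>

lemma tendsto_psi:
  "(\<lambda>N. psi (- (b * fps_X ^ (2 * N)) * fps_X) (- fps_X)) \<longlonglongrightarrow>
     (\<Sum>\<^sub>\<infinity>k\<in>{1..}. (- 1) ^ k * fps_X ^ (k\<^sup>2))"
proof -
  have "(\<lambda>N. infsum (psi_term (b * fps_X ^ (2 * N))) {1..}) \<longlonglongrightarrow> infsum (psi_term 0) {1..}"
  proof (rule tendsto_infsum_fps)
    fix n
    show "\<forall>\<^sub>F N in sequentially. \<forall>k\<in>{1..}.
            fps_nth (psi_term (b * fps_X ^ (2 * N)) k) n = fps_nth (psi_term 0 k) n"
      using eventually_gt_at_top[of n]
    proof eventually_elim
      case (elim N)
      have "fps_nth (psi_term (b * fps_X ^ (2 * N)) k) n = fps_nth (psi_term 0 k) n" for k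
      proof -
        define c where "c = b * fps_X ^ (2 * N)"
        obtain d where "(\<Prod>i<k. 1 + c * fps_X ^ (2 * i + 1)) - 1 = c * d"
          using dvd_prod_one_plus_minus_one by (metis dvdE)
        hence "psi_term c k * (1 + c * d) = psi_term 0 k"
          using psi_term_mult[of c k] by (simp add: psi_term_0 algebra_simps)
        hence "psi_term 0 k - psi_term c k = psi_term c k * b * d * fps_X ^ (2 * N)"
          unfolding c_def by (simp add: algebra_simps)
        hence "fps_nth (psi_term 0 k - psi_term c k) n = 0"
          using elim by (simp add: fps_nth_mult_X_power_eq_0)
        thus ?thesis
          by (simp add: c_def)
      qed
      thus ?case ..
    qed
  qed (rule psi_term_summable)+
  thus ?thesis
    by (simp only: psi_eq_infsum psi_term_0)
qed

text \<open>At \<open>b = 0\<close> only the empty set survives, with weight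
  \<open>0 ^ 0 = 1\<close>.\<close>

lemma tendsto_set_gf:
  fixes b :: "'a::field fps"
  shows "(\<lambda>N. set_gf (b * fps_X ^ (2 * N))) \<longlonglongrightarrow> 1"
proof -
  have "(set_weight (0 :: 'a fps) has_sum sum (set_weight 0) {{}}) {S. finite S}"
    by (rule has_sum_finite_neutralI[where B = "{{}}"]) (auto simp: set_weight_def)
  hence "infsum (set_weight (0 :: 'a fps)) {S. finite S} = 1"
    by (simp add: infsumI set_weight_def)
  thus ?thesis
    using tendsto_set_weight_0[of "{S. finite S}" b] by (simp add: set_gf_def)
qed

text \<open>Here the empty set is excluded, so nothing survives at \<open>b = 0\<close>.\<close>

lemma tendsto_odd_Min_gf:
  fixes b :: "'a::field fps"
  shows "(\<lambda>N. odd_Min_gf (b * fps_X ^ (2 * N))) \<longlonglongrightarrow> 0"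
proof -
  have "infsum (set_weight (0 :: 'a fps)) odd_Min_sets = 0"
    by (rule infsum_0) (auto simp: odd_Min_sets_def set_weight_def)
  moreover have "odd_Min_sets \<subseteq> {S. finite S}"
    by (auto simp: odd_Min_sets_def)
  ultimately show ?thesis
    using tendsto_set_weight_0[of odd_Min_sets b] by (simp add: odd_Min_gf_def)
qed

theorem theorem5p4:
  fixes \<alpha> :: "'a::field"
  shows "qpoch_inf (- fps_const \<alpha>) fps_X * psi (- fps_const \<alpha> * fps_X) (- fps_X) =
           - (\<Sum>\<^sub>\<infinity>\<nu>\<in>P_do. fps_const \<alpha> ^ size \<nu> * fps_X ^ sum_mset \<nu>)
           + (\<Sum>\<^sub>\<infinity>k\<in>{1..}. (- 1) ^ k * fps_X ^ (k\<^sup>2))"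
proof -
  define F where "F b = set_gf b * psi (- b * fps_X) (- fps_X) + odd_Min_gf b" for b :: "'a fps"
  have F_shift: "F b = F (b * fps_X ^ 2)" for b
  proof -
    \<comment> \<open>Two factors split off the product are exactly those required by
      \<open>psi_rec\<close>. The resulting term \<open>- b * fps_X * set_gf (b * fps_X ^ 2)\<close>
      then cancels the one from \<open>odd_Min_gf_rec\<close>.\<close>
    have "set_gf b * psi (- b * fps_X) (- fps_X) =
        set_gf (b * fps_X ^ 2) * ((1 + b) * (1 + b * fps_X) * psi (- b * fps_X) (- fps_X))"
      by (subst set_gf_rec, subst set_gf_rec) (simp add: power2_eq_square mult_ac)
    thus ?thesis
      unfolding psi_rec F_def by (subst odd_Min_gf_rec) (simp add: algebra_simps)
  qed
  have "F (fps_const \<alpha>) = F (fps_const \<alpha> * fps_X ^ (2 * N))" for N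
  proof (induction N)
    case (Suc N)
    have eq: "fps_const \<alpha> * fps_X ^ (2 * Suc N) = fps_const \<alpha> * fps_X ^ (2 * N) * fps_X ^ 2"
      by (simp add: power2_eq_square mult_ac)
    show ?case
      unfolding eq using Suc F_shift by (rule trans)
  qed simp
  moreover have "(\<lambda>N. F (fps_const \<alpha> * fps_X ^ (2 * N))) \<longlonglongrightarrow>
      1 * (\<Sum>\<^sub>\<infinity>k\<in>{1..}. (- 1) ^ k * fps_X ^ (k\<^sup>2)) + 0"
    unfolding F_def by (intro tendsto_intros tendsto_set_gf tendsto_psi tendsto_odd_Min_gf)
  ultimately have "F (fps_const \<alpha>) = (\<Sum>\<^sub>\<infinity>k\<in>{1..}. (- 1) ^ k * fps_X ^ (k\<^sup>2))"
    by (simp add: LIMSEQ_const_iff)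
  thus ?thesis
    unfolding F_def qpoch_inf_eq_set_gf odd_Min_gf_eq_P_do
    by (simp only: uminus_add_conv_diff eq_diff_eq)
qed

end
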